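(* Let $(X,\langle\cdot|\cdot\rangle)$ be a complex Hilbert space and let $T\subset X$ be an orthonormal system. Then the closure $\overline{\mathcal L(\mathbb R)(T)}$ in $X$ is a real linear subspace of $X$, and $\overline{\mathcal L(\mathbb R)(T)}\times\overline{\mathcal L(\mathbb R)(T)}$ is a subset of $\mathcal R_X$; that is, every pair $y,z\in\overline{\mathcal L(\mathbb R)(T)}$ with $y,z\neq0$ has a real angle, $\angle(y,z)\in\mathbb R$.
   Context: A complex Hilbert space is a complete complex inner product space; the inner product is homogeneous over $\mathbb C$ in the first component, conjugate symmetric, positive definite and additive, and $\|x\|=\sqrt{\langle x|x\rangle}$. An orthonormal system is a nonempty subset $T\subset X$ with $\langle x|y\rangle=0$ for all distinct $x,y\in T$ and $\langle x|x\rangle=1$ for all $x\in T$. $\mathcal L(\mathbb R)(T):=\{\sum_{i=1}^n r_i x_i\mid n\in\mathbb N,\ r_1,\dots,r_n\in\mathbb R,\ x_1,\dots,x_n\in T\}$ is the set of finite real linear combinations of elements of $T$. $\mathcal R_X:=\{(x,y)\in X\times X\mid\langle x|y\rangle\in\mathbb R\}$. For $x,y\in X\setminus\{0\}$ the angle is $\angle(x,y):=\arccos\big(\langle x|y\rangle/(\|x\|\,\|y\|)\big)$, where $\arccos:\mathcal B\to\mathcal A$ is the inverse of the homeomorphism $\cos:\mathcal A\to\mathcal B$ obtained by restricting the complex cosine, with $\mathcal A:=\{a+ib\mid 0<a<\pi,\ b\in\mathbb R\}\cup\{0,\pi\}$ and $\mathcal B:=\mathbb C\setminus\{r\in\mathbb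 R\mid r<-1\text{ or }r>1\}$. *)

theory Defs
  imports "HOL-Analysis.Analysis"
begin

section \<open>Complex Hilbert spaces\<close>

text \<open>
  The library has real inner product spaces only. The real scalar multiplication of
  \<^class>\<open>real_vector\<close> is tied to the complex one, so that the library's norm, metric,
  topology and real subspaces are those of the complex space.
\<close>

class complex_vector = real_vector +
  fixes scaleC :: "complex \<Rightarrow> 'a \<Rightarrow> 'a"  (infixr \<open>*\<^sub>C\<close> 75)
  assumes scaleC_add_right: "a *\<^sub>C (x + y) = a *\<^sub>C x + a *\<^sub>C y"
    and scaleC_add_left: "(a + b) *\<^sub>C x = a *\<^sub>C x + b *\<^sub>C x"
    and scaleC_scaleC: "a *\<^sub>C (b *\<^sub>C x) = (a * b) *\<^sub>C x"
    and scaleC_one: "1 *\<^sub>C x = x"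
    and scaleR_scaleC: "r *\<^sub>R x = complex_of_real r *\<^sub>C x"

text \<open>
  Linear in the first component. Since \<open>cinner_commute\<close> makes \<open>cinner x x\<close> real, positive
  definiteness only speaks about its real part. The norm axioms inherited from
  \<^class>\<open>real_normed_vector\<close> follow from the inner product axioms and \<open>norm_eq_sqrt_cinner\<close>
  (by Cauchy-Schwarz), so they are no restriction.
\<close>

class complex_inner = complex_vector + real_normed_vector +
  fixes cinner :: "'a \<Rightarrow> 'a \<Rightarrow> complex"
  assumes cinner_add_left: "cinner (x + y) z = cinner x z + cinner y z"
    and cinner_scaleC_left: "cinner (a *\<^sub>C x) y = a * cinner x y"
    and cinner_commute: "cinner x y = cnj (cinner y x)"
    and cinner_pos: "x \<noteq> 0 \<Longrightarrow> 0 < Re (cinner x x)"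
    and norm_eq_sqrt_cinner: "norm x = sqrt (Re (cinner x x))"

class complex_hilbert_space = complex_inner + complete_space

instantiation complex :: complex_hilbert_space
begin

definition scaleC_complex :: "complex \<Rightarrow> complex \<Rightarrow> complex"
  where "scaleC_complex a x = a * x"

definition cinner_complex :: "complex \<Rightarrow> complex \<Rightarrow> complex"
  where "cinner_complex x y = x * cnj y"

instance
proof
  fix a b x y z :: complex and r :: real
  show "x \<noteq> 0 \<Longrightarrow> 0 < Re (cinner x x)"
    by (simp add: cinner_complex_def complex_eq_iff sum_squares_gt_zero_iff)
  show "norm x = sqrt (Re (cinner x x))"
    by (simp add: cinner_complex_def cmod_def power2_eq_square)
qed (simp_all add: scaleC_complex_def cinner_complex_def algebra_simps scaleR_conv_of_real)

end

section \<open>Orthonormal systems and real linear combinations\<close>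

definition orthonormal_system :: "'a::complex_inner set \<Rightarrow> bool"
  where "orthonormal_system T \<longleftrightarrow>
    T \<noteq> {} \<and> (\<forall>x\<in>T. \<forall>y\<in>T. x \<noteq> y \<longrightarrow> cinner x y = 0) \<and> (\<forall>x\<in>T. cinner x x = 1)"

definition real_lin_combs :: "'a::complex_vector set \<Rightarrow> 'a set"
  where "real_lin_combs T =
    {\<Sum>i=1..n. r i *\<^sub>R x i | (n::nat) (r :: nat \<Rightarrow> real) (x :: nat \<Rightarrow> 'a). \<forall>i\<in>{1..n}. x i \<in> T}"

definition real_product_pairs :: "('a::complex_inner \<times> 'a) set"
  where "real_product_pairs = {(x, y). cinner x y \<in> \<real>}"

section \<open>Angles\<close>

definition angle_strip :: "complex set"
  where "angle_strip = {z. 0 < Re z \<and> Re z < pi} \<union> {0, complex_of_real pi}"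

definition slit_plane :: "complex set"
  where "slit_plane = UNIV - {complex_of_real r | r. r < - 1 \<or> r > 1}"

definition carccos :: "complex \<Rightarrow> complex"
  where "carccos = the_inv_into angle_strip cos"

text \<open>Meaningful for nonzero \<open>x\<close> and \<open>y\<close> only.\<close>

definition cangle :: "'a::complex_inner \<Rightarrow> 'a \<Rightarrow> complex"
  where "cangle x y = carccos (cinner x y / complex_of_real (norm x * norm y))"

text \<open>The inverse in \<^const>\<open>carccos\<close> is well defined:\<close>

lemma bij_betw_cos_angle_strip: "bij_betw cos angle_strip slit_plane"
proof (rule bij_betw_imageI)
  show "inj_on cos angle_strip"
  proof (rule inj_on_inverseI)
    show "Arccos (cos z) = z" if "z \<in> angle_strip" for z
      using that by (intro Arccos_cos) (auto simp: angle_strip_def)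
  qed
  show "cos ` angle_strip = slit_plane"
  proof (intro set_eqI iffI)
    fix w assume "w \<in> cos ` angle_strip"
    then obtain z where z: "z \<in> angle_strip" "w = cos z" by blast
    show "w \<in> slit_plane"
    proof (rule ccontr)
      assume "w \<notin> slit_plane"
      then obtain r where r: "w = complex_of_real r" "r < - 1 \<or> r > 1"
        by (auto simp: slit_plane_def)
      have "z \<noteq> 0" "z \<noteq> of_real pi"
        using r z(2) of_real_eq_iff[where 'a = complex, of r 1]
          of_real_eq_iff[where 'a = complex, of r "-1"]
        by (auto simp: cos_of_real simp del: of_real_eq_iff)
      then have s: "sin (Re z) > 0"
        using z(1) by (auto simp: angle_strip_def sin_gt_zero)
      have "Im (cos z) = 0"
        using z(2) r(1) by (metis Im_complex_of_real)
      then have "Im z = 0"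
        using s by (simp add: Im_cos)
      then have "r = cos (Re z)"
        using z(2) r(1) by (metis Re_complex_of_real Re_cos add.commute add.inverse_neutral
            exp_zero mult.commute mult_2 nonzero_mult_div_cancel_left one_add_one zero_neq_numeral)
      then show False
        using r(2) cos_ge_minus_one[of "Re z"] cos_le_one[of "Re z"] by linarith
    qed
  next
    fix w assume w: "w \<in> slit_plane"
    define z where "z = Arccos w"
    have cz: "cos z = w" by (simp add: z_def)
    have b: "- pi < Re z" "Re z \<le> pi" using Re_Arccos_bounds[of w] by (auto simp: z_def)
    have end_case: "w \<in> cos ` angle_strip" if s: "sin (Re z) = 0"
    proof -
      have "Im w = 0" using s cz by (auto simp: Im_cos)
      then have wr: "w = of_real (Re w)" by (simp add: complex_eq_iff)
      then have bw: "\<bar>Re w\<bar> \<le> 1"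
        using w by (fastforce simp: slit_plane_def abs_le_iff not_less)
      have "w = cos (of_real (arccos (Re w)))"
        using bw wr by (simp add: cos_of_real)
      moreover have "complex_of_real (arccos (Re w)) \<in> angle_strip"
        using bw arccos_bounded[of "Re w"] by (auto simp: angle_strip_def less_le)
      ultimately show ?thesis by blast
    qed
    consider "Re z = 0 \<or> Re z = pi" | "0 < Re z" "Re z < pi" | "Re z < 0"
      using b by linarith
    then show "w \<in> cos ` angle_strip"
    proof cases
      case 1
      then show ?thesis using end_case by auto
    next
      case 2
      then show ?thesis using cz by (force simp: angle_strip_def)
    next
      case 3
      then have "- z \<in> angle_strip" "w = cos (- z)"
        using b cz by (auto simp: angle_strip_def)
      then show ?thesis by blast
    qed
  qed
qed

end

theory Submission
  imports Defs
begin

text \<open>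
  The finite real linear combinations of \<open>T\<close> form the real span of \<open>T\<close>, and closures of subspaces
  are subspaces. For fixed \<open>y\<close> the map \<open>x \<mapsto> Im \<langle>x|y\<rangle>\<close> is real linear and bounded, so its kernel
  is a closed real subspace, which contains the closure of the span as soon as it contains \<open>T\<close>.
  Using this for \<open>y \<in> T\<close>, and then, by conjugate symmetry, for \<open>y\<close> in the closure, shows that the
  inner product is real there. By Cauchy-Schwarz the angle of such a pair is the value of the real
  arc cosine at a point of \<open>[-1, 1]\<close>.
\<close>

lemma subspace_closure:
  fixes S :: "'a::real_normed_vector set"
  assumes "subspace S"
  shows "subspace (closure S)"
proof (rule subspaceI)
  show "0 \<in> closure S"
    using subspace_0[OF assms] closure_subset by blast
next
  fix x y assume "x \<in> closure S" "y \<in> closure S"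
  then obtain f g where "\<forall>n. f n \<in> S" "f \<longlonglongrightarrow> x" "\<forall>n. g n \<in> S" "g \<longlonglongrightarrow> y"
    by (auto simp: closure_sequential)
  then have "\<forall>n. f n + g n \<in> S" "(\<lambda>n. f n + g n) \<longlonglongrightarrow> x + y"
    by (auto intro: subspace_add[OF assms] tendsto_add)
  then show "x + y \<in> closure S"
    unfolding closure_sequential by (intro exI conjI)
next
  fix c :: real and x assume "x \<in> closure S"
  then obtain f where "\<forall>n. f n \<in> S" "f \<longlonglongrightarrow> x"
    by (auto simp: closure_sequential)
  then have "\<forall>n. c *\<^sub>R f n \<in> S" "(\<lambda>n. c *\<^sub>R f n) \<longlonglongrightarrow> c *\<^sub>R x"
    by (auto intro: subspace_scale[OF assms] tendsto_scaleR)
  then show "c *\<^sub>R x \<in> closure S"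
    unfolding closure_sequential by (intro exI conjI)
qed

lemma cinner_scaleR_left:
  fixes x y :: "'a::complex_inner"
  shows "cinner (r *\<^sub>R x) y = of_real r * cinner x y"
  by (simp add: scaleR_scaleC cinner_scaleC_left)

lemma power2_norm_eq_Re_cinner:
  fixes x :: "'a::complex_inner"
  shows "(norm x)\<^sup>2 = Re (cinner x x)"
proof -
  \<comment> \<open>\<open>sqrt\<close> is odd on the reals, so a nonnegative root forces a
    nonnegative argument; this covers \<open>x = 0\<close> as well.\<close>
  have "0 \<le> sqrt (Re (cinner x x))"
    using norm_ge_zero[of x] by (simp only: norm_eq_sqrt_cinner)
  then show ?thesis
    by (simp add: norm_eq_sqrt_cinner)
qed

lemma norm_add_power2:
  fixes x y :: "'a::complex_inner"
  shows "(norm (x + y))\<^sup>2 = (norm x)\<^sup>2 + (norm y)\<^sup>2 + 2 * Re (cinner x y)"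
proof -
  have "cinner (x + y) (x + y) = cinner x (x + y) + cinner y (x + y)"
    by (rule cinner_add_left)
  moreover have "cinner z (x + y) = cinner z x + cinner z y" for z
    by (metis cinner_add_left cinner_commute complex_cnj_add)
  moreover have "Re (cinner y x) = Re (cinner x y)"
    by (subst cinner_commute) simp
  ultimately show ?thesis
    by (simp add: power2_norm_eq_Re_cinner)
qed

text \<open>The usual derivation is reversed: the triangle inequality belongs to the norm axioms,
  and squaring and expanding it leaves this half of Cauchy-Schwarz.\<close>

lemma Re_cinner_le_norm:
  fixes x y :: "'a::complex_inner"
  shows "Re (cinner x y) \<le> norm x * norm y"
proof -
  have "(norm (x + y))\<^sup>2 \<le> (norm x + norm y)\<^sup>2"
    by (intro power_mono norm_triangle_ineq norm_ge_zero)
  then show ?thesis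
    by (simp add: norm_add_power2 power2_sum)
qed

lemma abs_Re_cinner_le_norm:
  fixes x y :: "'a::complex_inner"
  shows "\<bar>Re (cinner x y)\<bar> \<le> norm x * norm y"
  using Re_cinner_le_norm[of x y] Re_cinner_le_norm[of "- x" y]
    cinner_scaleR_left[of "- 1" x y]
  by simp

lemma norm_scaleC_ii:
  fixes x :: "'a::complex_inner"
  shows "norm (\<i> *\<^sub>C x) = norm x"
proof -
  have "cinner (\<i> *\<^sub>C x) (\<i> *\<^sub>C x) = \<i> * cnj (\<i> * cinner x x)"
    by (metis cinner_commute cinner_scaleC_left)
  \<comment> \<open>\<open>\<i> * cnj \<i> = 1\<close>, and \<open>cinner x x\<close> equals its own
    conjugate.\<close>
  also have "\<dots> = cinner x x"
    using cinner_commute[of x x] by simp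
  finally show ?thesis
    by (simp add: norm_eq_sqrt_cinner)
qed

lemma bounded_linear_Im_cinner_left:
  fixes y :: "'a::complex_inner"
  shows "bounded_linear (\<lambda>x. Im (cinner x y))"
proof (rule bounded_linear_intro[where K = "norm y"])
  fix x :: 'a
  \<comment> \<open>Multiplication by \<open>\<i>\<close> turns the imaginary part into a real part
    and preserves the norm, so the bound for real parts applies.\<close>
  have "Im (cinner x y) = - Re (cinner (\<i> *\<^sub>C x) y)"
    by (simp add: cinner_scaleC_left)
  then show "norm (Im (cinner x y)) \<le> norm x * norm y"
    using abs_Re_cinner_le_norm[of "\<i> *\<^sub>C x" y] by (simp add: norm_scaleC_ii)
qed (simp_all add: cinner_add_left cinner_scaleR_left)

lemma closure_span_cinner_Reals:
  fixes x y :: "'a::complex_inner"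
  assumes "x \<in> closure (span T)" and "\<And>t. t \<in> T \<Longrightarrow> cinner t y \<in> \<real>"
  shows "cinner x y \<in> \<real>"
proof -
  interpret bounded_linear "\<lambda>x. Im (cinner x y)"
    by (rule bounded_linear_Im_cinner_left)
  let ?K = "{x. Im (cinner x y) = 0}"
  have "closed ?K"
    by (intro closed_Collect_eq continuous_on continuous_on_const continuous_on_id)
  moreover have "span T \<subseteq> ?K"
    using assms(2) by (intro span_minimal) (auto simp: complex_is_Real_iff subspace_def zero add scale)
  ultimately have "closure (span T) \<subseteq> ?K"
    by (intro closure_minimal)
  then show ?thesis
    using assms(1) by (auto simp: complex_is_Real_iff)
qed

lemma cinner_Reals_commute:
  fixes x y :: "'a::complex_inner"
  shows "cinner x y \<in> \<real> \<longleftrightarrow> cinner y x \<in> \<real>"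
  by (subst cinner_commute) (simp add: complex_is_Real_iff)

lemma real_lin_combs_eq_span: "real_lin_combs T = span T"
proof
  show "real_lin_combs T \<subseteq> span T"
    by (auto simp: real_lin_combs_def intro!: span_sum span_scale intro: span_base)
next
  show "span T \<subseteq> real_lin_combs T"
  proof
    fix v assume "v \<in> span T"
    then obtain S r where S: "finite S" "S \<subseteq> T" and v: "v = (\<Sum>a\<in>S. r a *\<^sub>R a)"
      by (auto simp: span_explicit)
    \<comment> \<open>An enumeration starting at 1 matches the index range of
      \<open>real_lin_combs\<close>; an empty \<open>S\<close> gives the empty sum, with
      \<open>n = 0\<close>.\<close>
    obtain h where h: "bij_betw h {1..card S} S"
      using ex_bij_betw_nat_finite_1[OF S(1)] by blast
    have "v = (\<Sum>i=1..card S. r (h i) *\<^sub>R h i)"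
      unfolding v by (rule sum.reindex_bij_betw[OF h, symmetric])
    moreover have "\<forall>i\<in>{1..card S}. h i \<in> T"
      using S(2) bij_betwE[OF h] by blast
    ultimately show "v \<in> real_lin_combs T"
      unfolding real_lin_combs_def
      by (intro CollectI exI[of _ "card S"] exI[of _ "\<lambda>i. r (h i)"] exI[of _ h]) simp
  qed
qed

text \<open>The real \<open>arccos\<close> takes values in \<open>[0, pi]\<close>, which lies in
  \<open>angle_strip\<close> with both endpoints, so injectivity of \<open>cos\<close> there
  identifies the two inverses.\<close>

lemma carccos_of_real:
  assumes "\<bar>r\<bar> \<le> 1"
  shows "carccos (of_real r) = of_real (arccos r)"
  unfolding carccos_def
proof (rule the_inv_into_f_eq)
  show "inj_on cos angle_strip"
    using bij_betw_cos_angle_strip by (rule bij_betw_imp_inj_on)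
  show "cos (complex_of_real (arccos r)) = of_real r"
    using assms by (simp add: cos_of_real)
  show "complex_of_real (arccos r) \<in> angle_strip"
    using assms arccos_bounded[of r] by (auto simp: angle_strip_def less_le)
qed

lemma cangle_Reals:
  fixes x y :: "'a::complex_inner"
  assumes "cinner x y \<in> \<real>"
  shows "cangle x y \<in> \<real>"
proof -
  define r where "r = Re (cinner x y) / (norm x * norm y)"
  have "cinner x y / complex_of_real (norm x * norm y) = of_real r"
    using assms by (simp add: r_def)
  \<comment> \<open>If a norm vanishes, division by zero yields \<open>r = 0\<close>; otherwise this
    is Cauchy-Schwarz.\<close>
  moreover have "\<bar>r\<bar> \<le> 1"
    using abs_Re_cinner_le_norm[of x y] by (cases "norm x * norm y = 0") (simp_all add: r_def)
  ultimately show ?thesis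
    by (simp add: cangle_def carccos_of_real)
qed

theorem proposition4p3:
  fixes T :: "'a::complex_hilbert_space set"
  assumes "orthonormal_system T"
  shows "subspace (closure (real_lin_combs T))
    \<and> closure (real_lin_combs T) \<times> closure (real_lin_combs T) \<subseteq> real_product_pairs
    \<and> (\<forall>y\<in>closure (real_lin_combs T). \<forall>z\<in>closure (real_lin_combs T).
          y \<noteq> 0 \<and> z \<noteq> 0 \<longrightarrow> cangle y z \<in> \<real>)"
proof -
  have T: "cinner s t \<in> \<real>" if "s \<in> T" "t \<in> T" for s t
    using assms that by (cases "s = t") (auto simp: orthonormal_system_def)
  have "cinner y t \<in> \<real>" if "y \<in> closure (span T)" "t \<in> T" for y t
    using that T by (blast intro: closure_span_cinner_Reals)
  \<comment> \<open>The previous fact gives \<open>cinner z t\<close> real for \<open>t\<close> in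
    \<open>T\<close>; symmetry moves \<open>t\<close> to the first slot, where the closure argument
    extends it to \<open>y\<close>.\<close>
  then have real: "cinner y z \<in> \<real>" if "y \<in> closure (span T)" "z \<in> closure (span T)" for y z
    using that by (blast intro: closure_span_cinner_Reals cinner_Reals_commute[THEN iffD1])
  show ?thesis
    unfolding real_lin_combs_eq_span
    using real by (auto simp: real_product_pairs_def cangle_Reals subspace_closure)
qed

end
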